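(* Let $\mu$ be an inventory-agnostic policy that offers a deterministic sequence of assortments, let $\delta \ge 0$, and suppose that $\mu$ is locally-optimal with threshold $\delta$, that is, $\mathrm{rev}(M_{jt}(\mu,S)) \le \mathrm{rev}(\mu)+\delta$ for all $j\in\mathcal J$, $t\in\mathcal T$ and $S\subseteq\mathcal N$. Then $$\mathrm{rev}(\mu)\;\ge\;\tfrac12\,\mathrm{opt}^{\mathrm{det}}-\delta\,\tfrac{mT}{2}.$$ In particular, any locally-optimal policy with threshold zero is a $\tfrac12$-approximate policy with respect to $\mathrm{opt}^{\mathrm{det}}$, i.e. $\mathrm{rev}(\mu)\ge\frac12\mathrm{opt}^{\mathrm{det}}$.
   Context: Model. Products $\mathcal N=\{1,\dots,n\}$; product $i$ has revenue $r_i\ge 0$ and initial inventory $c_i\in\mathbb Z_+$. Customer types $\mathcal J=\{1,\dots,m\}$; time periods $\mathcal T=\{1,\dots,T\}$. At each period $t$ exactly one customer arrives, of type $j$ with probability $\lambda_{jt}\ge0$, $\sum_{j\in\mathcal J}\lambda_{jt}=1$; arrivals and choices at different periods are independent. If assortment $S\subseteq\mathcal N$ is offered to a type-$j$ customer, she chooses product $i$ with probability $\phi_{ij}(S)\ge0$ and chooses nothing with probability $1-\sum_{i\in\mathcal N}\phi_{ij}(S)\ge 0$; $\phi_{ij}(S)=0$ for $i\notin S$. Substitutability: $\phi_{ij}(S\cup\{\ell\})\le\phi_{ij}(S)$ for all $i\in S$, $\ell\notin S$, $j\in\mathcal J$, $S\subseteq\mathcal N$. Policies. A sampling-based inventory-agnostic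 policy $\mu$ is given by mutually independent random assortments $(S^\mu_{jt}: j\in\mathcal J, t\in\mathcal T)$, independent of arrivals and choices; if a type-$j$ customer arrives at period $t$, the assortment $S^\mu_{jt}$ is offered regardless of remaining inventories. If the customer chooses a product with no remaining inventory she leaves without a purchase; otherwise, if she chooses product $i$, one unit of its inventory is consumed and revenue $r_i$ is collected. $\mathrm{rev}(\mu)$ is the total expected revenue of $\mu$ over the selling horizon. Explicitly, with $\varphi^\mu_{it}=\sum_{j}\lambda_{jt}\sum_{S}\mathbb P\{S^\mu_{jt}=S\}\phi_{ij}(S)$ and, for each $i$, independent Bernoulli random variables $B^\mu_{it}$ ($t\in\mathcal T$) with parameters $\varphi^\mu_{it}$, $\mathrm{rev}(\mu)=\sum_{i}r_i\,\mathbb E\{\min\{c_i,\sum_{t\in\mathcal T}B^\mu_{it}\}\}$. A policy offers a deterministic sequence of assortments if every $S^\mu_{jt}$ is deterministic. $M_{jt}(\mu,S)$ denotes the policy obtained from $\mu$ by replacing $S^\mu_{jt}$ with the deterministic assortment $S$, keeping all else unchanged. $\mathrm{opt}^{\mathrm{det}}$ is the maximum of $\mathrm{rev}(\mu)$ over all inventory-agnostic policies that offer a deterministic sequence of assortments (equivalently, over all sampling-based inventory-agnostic policies). *)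

theory Defs
  imports "HOL-Probability.Probability"
begin

record assortment_model =
  num_products :: nat
  num_types :: nat
  num_periods :: nat
  unit_revenue :: "nat \<Rightarrow> real"
  inventory :: "nat \<Rightarrow> nat"
  arrival_prob :: "nat \<Rightarrow> nat \<Rightarrow> real"  \<comment> \<open>type, period\<close>
  choice_prob :: "nat \<Rightarrow> nat \<Rightarrow> nat set \<Rightarrow> real"  \<comment> \<open>product, type, offered assortment\<close>

definition products :: "assortment_model \<Rightarrow> nat set" where
  "products M = {1..num_products M}"

definition types :: "assortment_model \<Rightarrow> nat set" where
  "types M = {1..num_types M}"

definition periods :: "assortment_model \<Rightarrow> nat set" where
  "periods M = {1..num_periods M}"

definition valid_model :: "assortment_model \<Rightarrow> bool" where
  "valid_model M \<longleftrightarrow>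
     (\<forall>i\<in>products M. 0 \<le> unit_revenue M i) \<and>
     (\<forall>j\<in>types M. \<forall>t\<in>periods M. 0 \<le> arrival_prob M j t) \<and>
     (\<forall>t\<in>periods M. (\<Sum>j\<in>types M. arrival_prob M j t) = 1) \<and>
     (\<forall>j\<in>types M. \<forall>S. S \<subseteq> products M \<longrightarrow>
        (\<forall>i\<in>products M. 0 \<le> choice_prob M i j S) \<and>
        (\<forall>i\<in>products M - S. choice_prob M i j S = 0) \<and>
        (\<Sum>i\<in>products M. choice_prob M i j S) \<le> 1 \<and>
        (\<forall>i\<in>S. \<forall>l\<in>products M - S. choice_prob M i j (S \<union> {l}) \<le> choice_prob M i j S))"

text \<open>
  The random assortments of a sampling-based inventory-agnostic policy are mutually independent,
  so their joint law is determined by the marginal laws. A policy is the family of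
  these marginals, indexed by customer type and then period. Values at indices outside
  the model's types and periods are irrelevant.
\<close>

type_synonym policy = "nat \<Rightarrow> nat \<Rightarrow> nat set pmf"

definition sampling_policy :: "assortment_model \<Rightarrow> policy \<Rightarrow> bool" where
  "sampling_policy M \<mu> \<longleftrightarrow>
     (\<forall>j\<in>types M. \<forall>t\<in>periods M. set_pmf (\<mu> j t) \<subseteq> Pow (products M))"

definition deterministic_policy :: "assortment_model \<Rightarrow> policy \<Rightarrow> bool" where
  "deterministic_policy M \<mu> \<longleftrightarrow>
     sampling_policy M \<mu> \<and> (\<forall>j\<in>types M. \<forall>t\<in>periods M. \<exists>S. \<mu> j t = return_pmf S)"

definition modify :: "nat \<Rightarrow> nat \<Rightarrow> policy \<Rightarrow> nat set \<Rightarrow> policy" where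
  "modify j t \<mu> S = \<mu>(j := (\<mu> j)(t := return_pmf S))"

text \<open>
  The unconditional probability that the customer of a period chooses product \<open>i\<close>,
  whether or not any of it is left.
\<close>

definition demand_prob :: "assortment_model \<Rightarrow> policy \<Rightarrow> nat \<Rightarrow> nat \<Rightarrow> real" where
  "demand_prob M \<mu> i t =
     (\<Sum>j\<in>types M. arrival_prob M j t *
        (\<Sum>S\<in>Pow (products M). pmf (\<mu> j t) S * choice_prob M i j S))"

text \<open>
  \<open>demands M \<mu> i\<close> is the joint law of the independent Bernoulli indicators, one per period, that
  product \<open>i\<close> is chosen. The offered assortments ignore inventories, so the expected
  sales of \<open>i\<close> are the expectation of the total demand truncated at the initial inventory.
\<close>

definition demands :: "assortment_model \<Rightarrow> policy \<Rightarrow> nat \<Rightarrow> (nat \<Rightarrow> bool) pmf" where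
  "demands M \<mu> i = Pi_pmf (periods M) False (\<lambda>t. bernoulli_pmf (demand_prob M \<mu> i t))"

definition expected_revenue :: "assortment_model \<Rightarrow> policy \<Rightarrow> real" where
  "expected_revenue M \<mu> =
     (\<Sum>i\<in>products M. unit_revenue M i *
        measure_pmf.expectation (demands M \<mu> i)
          (\<lambda>B. real (min (inventory M i) (\<Sum>t\<in>periods M. of_bool (B t)))))"

definition opt_det :: "assortment_model \<Rightarrow> real" where
  "opt_det M = Max {expected_revenue M \<mu> | \<mu>. deterministic_policy M \<mu>}"

definition locally_optimal :: "assortment_model \<Rightarrow> policy \<Rightarrow> real \<Rightarrow> bool" where
  "locally_optimal M \<mu> \<delta> \<longleftrightarrow>
     (\<forall>j\<in>types M. \<forall>t\<in>periods M. \<forall>S. S \<subseteq> products M \<longrightarrow>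
        expected_revenue M (modify j t \<mu> S) \<le> expected_revenue M \<mu> + \<delta>)"

text \<open>\<open>bernoulli_pmf\<close> truncates its parameter to the unit interval; this never happens here.\<close>

lemma demand_prob_bounds:
  assumes "valid_model M" "sampling_policy M \<mu>" "i \<in> products M" "t \<in> periods M"
  shows "0 \<le> demand_prob M \<mu> i t" "demand_prob M \<mu> i t \<le> 1"
proof -
  have fin: "finite (products M)" by (simp add: products_def)
  let ?q = "\<lambda>j. \<Sum>S\<in>Pow (products M). pmf (\<mu> j t) S * choice_prob M i j S"
  have c: "0 \<le> choice_prob M i j S \<and> choice_prob M i j S \<le> 1"
    if "j \<in> types M" "S \<subseteq> products M" for j S
  proof -
    have nn: "\<forall>k\<in>products M. 0 \<le> choice_prob M k j S"
      and le: "(\<Sum>k\<in>products M. choice_prob M k j S) \<le> 1"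
      using assms(1) that unfolding valid_model_def by blast+
    have "choice_prob M i j S \<le> (\<Sum>k\<in>products M. choice_prob M k j S)"
      using nn assms(3) fin by (intro member_le_sum) auto
    then show ?thesis using nn le assms(3) by force
  qed
  have q0: "0 \<le> ?q j" if "j \<in> types M" for j
    using c[OF that] by (intro sum_nonneg mult_nonneg_nonneg) auto
  have q1: "?q j \<le> 1" if "j \<in> types M" for j
  proof -
    have "?q j \<le> (\<Sum>S\<in>Pow (products M). pmf (\<mu> j t) S * 1)"
      using c[OF that] by (intro sum_mono mult_left_mono) auto
    also have "\<dots> = measure (measure_pmf (\<mu> j t)) (Pow (products M))"
      using fin by (simp add: measure_measure_pmf_finite)
    also have "\<dots> \<le> 1" by simp
    finally show ?thesis .
  qed
  have l0: "\<And>j. j \<in> types M \<Longrightarrow> 0 \<le> arrival_prob M j t"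
    and l1: "(\<Sum>j\<in>types M. arrival_prob M j t) = 1"
    using assms(1,4) unfolding valid_model_def by blast+
  show "0 \<le> demand_prob M \<mu> i t"
    unfolding demand_prob_def by (rule sum_nonneg) (rule mult_nonneg_nonneg[OF l0 q0])
  have "demand_prob M \<mu> i t \<le> (\<Sum>j\<in>types M. arrival_prob M j t * 1)"
    unfolding demand_prob_def by (rule sum_mono) (rule mult_left_mono[OF q1 l0])
  then show "demand_prob M \<mu> i t \<le> 1" using l1 by simp
qed

text \<open>The maximum in \<open>opt_det\<close> ranges over a finite nonempty set, hence is attained.\<close>

lemma finite_deterministic_revenues:
  "finite {expected_revenue M \<mu> | \<mu>. deterministic_policy M \<mu>}"
proof -
  let ?F = "PiE (types M \<times> periods M) (\<lambda>_. Pow (products M))"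
  let ?g = "\<lambda>f j t. return_pmf (f (j, t)) :: nat set pmf"
  have "expected_revenue M \<mu> \<in> (\<lambda>f. expected_revenue M (?g f)) ` ?F"
    if d: "deterministic_policy M \<mu>" for \<mu>
  proof -
    obtain h where h: "\<And>j t. j \<in> types M \<Longrightarrow> t \<in> periods M \<Longrightarrow> \<mu> j t = return_pmf (h j t)"
      using d unfolding deterministic_policy_def by metis
    let ?f = "restrict (\<lambda>(j, t). h j t) (types M \<times> periods M)"
    have "h j t \<subseteq> products M" if "j \<in> types M" "t \<in> periods M" for j t
      using d h[OF that] that unfolding deterministic_policy_def sampling_policy_def by fastforce
    then have mem: "?f \<in> ?F" by auto
    have "demand_prob M \<mu> i t = demand_prob M (?g ?f) i t" if "t \<in> periods M" for i t
      unfolding demand_prob_def using h that by (intro sum.cong) auto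
    then have "demands M \<mu> = demands M (?g ?f)"
      unfolding demands_def by (intro ext Pi_pmf_cong) auto
    then have "expected_revenue M \<mu> = expected_revenue M (?g ?f)"
      unfolding expected_revenue_def by simp
    then show ?thesis using mem by blast
  qed
  then have "{expected_revenue M \<mu> | \<mu>. deterministic_policy M \<mu>}
      \<subseteq> (\<lambda>f. expected_revenue M (?g f)) ` ?F" by blast
  moreover have "finite ?F"
    by (intro finite_PiE) (auto simp: types_def periods_def products_def)
  ultimately show ?thesis by (meson finite_imageI finite_subset)
qed

lemma deterministic_revenues_nonempty:
  "{expected_revenue M \<mu> | \<mu>. deterministic_policy M \<mu>} \<noteq> {}"
proof -
  have "deterministic_policy M (\<lambda>_ _. return_pmf {})"
    by (auto simp: deterministic_policy_def sampling_policy_def)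
  then show ?thesis by blast
qed

end

theory Submission
  imports Defs
begin

text \<open>
  For one product with inventory \<open>c\<close>, the expected sales are affine in each period's demand
  probability \<open>p t\<close>, with slope \<open>D t\<close> the probability that the other periods leave stock.
  Two inequalities follow, both from pointwise bounds on the truncated demand: the sales
  under \<open>q\<close> are at most the sales under \<open>p\<close> plus \<open>\<Sum>t. q t * D t\<close>, and \<open>\<Sum>t. p t * D t\<close>
  is at most the sales under \<open>p\<close>. Since \<open>q\<close> and \<open>p\<close> are sums of contributions of types,
  local optimality, summed over types and periods with the optimal assortments as replacements,
  bounds the revenue-weighted \<open>\<Sum>t. q t * D t\<close> by that of \<open>\<Sum>t. p t * D t\<close> plus \<open>\<delta> m T\<close>.
\<close>

section \<open>Expected sales of one product as a function of its demand probabilities\<close>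

abbreviation bernoullis :: "'a set \<Rightarrow> ('a \<Rightarrow> real) \<Rightarrow> ('a \<Rightarrow> bool) pmf" where
  "bernoullis A p \<equiv> Pi_pmf A False (\<lambda>t. bernoulli_pmf (p t))"

definition trials :: "'a set \<Rightarrow> ('a \<Rightarrow> bool) \<Rightarrow> nat" where
  "trials A B = (\<Sum>t\<in>A. of_bool (B t))"

definition sales :: "'a set \<Rightarrow> nat \<Rightarrow> ('a \<Rightarrow> real) \<Rightarrow> real" where
  "sales A c p = measure_pmf.expectation (bernoullis A p) (\<lambda>B. real (min c (trials A B)))"

text \<open>All periods other than \<open>t\<close> count, the later ones too: total sales do not
  depend on the order of demands, so this is the marginal value of a demand at \<open>t\<close>, not
  the chance that stock remains when \<open>t\<close> begins.\<close>

definition stock_prob :: "'a set \<Rightarrow> nat \<Rightarrow> ('a \<Rightarrow> real) \<Rightarrow> 'a \<Rightarrow> real" where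
  "stock_prob A c p t =
     measure_pmf.expectation (bernoullis (A - {t}) p) (\<lambda>B. of_bool (trials (A - {t}) B < c))"

lemma integrable_bernoullis:
  fixes g :: "('a \<Rightarrow> bool) \<Rightarrow> real"
  assumes "finite A"
  shows "integrable (measure_pmf (bernoullis A p)) g"
proof -
  have "finite (set_pmf (bernoullis A p))"
    using assms by (simp add: set_Pi_pmf finite_PiE_dflt)
  then show ?thesis by (rule integrable_measure_pmf_finite)
qed

text \<open>Conditioning on coordinate \<open>t\<close>, which is independent of the others. The
  bounds on \<open>p t\<close> enter because \<open>bernoulli_pmf\<close> clips its parameter to the
  unit interval.\<close>

lemma expectation_bernoullis_split:
  fixes g :: "('a \<Rightarrow> bool) \<Rightarrow> real"
  assumes "finite A" "t \<in> A" "0 \<le> p t" "p t \<le> 1"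
  shows "measure_pmf.expectation (bernoullis A p) g =
    p t * measure_pmf.expectation (bernoullis (A - {t}) p) (\<lambda>B. g (B(t := True))) +
    (1 - p t) * measure_pmf.expectation (bernoullis (A - {t}) p) (\<lambda>B. g (B(t := False)))"
proof -
  have "bernoullis A p = bernoulli_pmf (p t) \<bind>
      (\<lambda>x. map_pmf (\<lambda>B. B(t := x)) (bernoullis (A - {t}) p))"
    using assms Pi_pmf_insert'[of "A - {t}" t False "\<lambda>t. bernoulli_pmf (p t)"]
    by (simp add: insert_absorb map_pmf_def)
  also have "measure_pmf.expectation \<dots> g = (\<Sum>x\<in>UNIV. pmf (bernoulli_pmf (p t)) x *\<^sub>R
      measure_pmf.expectation (map_pmf (\<lambda>B. B(t := x)) (bernoullis (A - {t}) p)) g)"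
    using assms(1) by (intro pmf_expectation_bind) (auto simp: set_Pi_pmf finite_PiE_dflt)
  finally show ?thesis
    using assms by (simp add: UNIV_bool fun_upd_def)
qed

lemma trials_upd [simp]:
  assumes "finite A" "t \<in> A"
  shows "trials A (B(t := b)) = trials (A - {t}) B + of_bool b"
proof -
  have "(\<Sum>s\<in>A - {t}. of_bool ((B(t := b)) s)) = (\<Sum>s\<in>A - {t}. of_bool (B s) :: nat)"
    by (intro sum.cong) auto
  then show ?thesis
    unfolding trials_def by (subst sum.remove[OF assms]) simp
qed

text \<open>One further demand raises \<open>min c x\<close> by one if \<open>x < c\<close>, and by
  nothing otherwise.\<close>

lemma sales_split:
  assumes "finite A" "t \<in> A" "0 \<le> p t" "p t \<le> 1"
  shows "sales A c p = sales (A - {t}) c p + p t * stock_prob A c p t"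
proof -
  let ?E = "measure_pmf.expectation (bernoullis (A - {t}) p)"
  have "?E (\<lambda>B. real (min c (trials (A - {t}) B + 1))) =
      ?E (\<lambda>B. real (min c (trials (A - {t}) B)) + of_bool (trials (A - {t}) B < c))"
    by (intro Bochner_Integration.integral_cong) auto
  also have "\<dots> = sales (A - {t}) c p + stock_prob A c p t"
    unfolding sales_def stock_prob_def using assms(1)
    by (intro Bochner_Integration.integral_add integrable_bernoullis) auto
  finally show ?thesis
    using assms unfolding sales_def[of A]
    by (subst expectation_bernoullis_split[of A t]) (simp_all add: sales_def algebra_simps)
qed

lemma bernoullis_cong:
  assumes "\<And>s. s \<in> A \<Longrightarrow> p s = q s"
  shows "bernoullis A p = bernoullis A q"
  using assms by (intro Pi_pmf_cong) auto

text \<open>Intercept and slope in \<open>sales_split\<close> involve only the other periods, where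
  \<open>p\<close> and \<open>q\<close> agree.\<close>

lemma sales_change:
  assumes "finite A" "t \<in> A" "p t \<in> {0..1}" "q t \<in> {0..1}"
    and "\<And>s. s \<in> A - {t} \<Longrightarrow> q s = p s"
  shows "sales A c q = sales A c p + (q t - p t) * stock_prob A c p t"
proof -
  have "bernoullis (A - {t}) q = bernoullis (A - {t}) p"
    using assms(5) by (rule bernoullis_cong)
  then show ?thesis
    using assms sales_split[of A t p c] sales_split[of A t q c]
    by (simp add: sales_def stock_prob_def algebra_simps)
qed

text \<open>When \<open>B t\<close> holds, the other periods leave stock exactly if the total, with
  the demand at \<open>t\<close> included, is at most \<open>c\<close>. This puts all periods under
  one common law, so that they can be summed pointwise.\<close>

lemma prob_weighted_stock_prob:
  assumes "finite A" "t \<in> A" "p t \<in> {0..1}"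
  shows "p t * stock_prob A c p t = measure_pmf.expectation (bernoullis A p)
    (\<lambda>B. of_bool (B t) * of_bool (trials A B \<le> c))"
  using assms
  by (subst expectation_bernoullis_split[of A t])
     (simp_all add: stock_prob_def Suc_le_eq)

lemma sum_prob_weighted_stock_prob_le_sales:
  assumes "finite A" "\<And>t. t \<in> A \<Longrightarrow> p t \<in> {0..1}"
  shows "(\<Sum>t\<in>A. p t * stock_prob A c p t) \<le> sales A c p"
proof -
  let ?E = "measure_pmf.expectation (bernoullis A p)"
  have "(\<Sum>t\<in>A. p t * stock_prob A c p t) =
      (\<Sum>t\<in>A. ?E (\<lambda>B. of_bool (B t) * of_bool (trials A B \<le> c)))"
    using assms by (intro sum.cong refl prob_weighted_stock_prob) auto
  also have "\<dots> = ?E (\<lambda>B. \<Sum>t\<in>A. of_bool (B t) * of_bool (trials A B \<le> c))"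
    using assms(1) by (intro Bochner_Integration.integral_sum[symmetric] integrable_bernoullis)
  also have "\<dots> = ?E (\<lambda>B. real (trials A B) * of_bool (trials A B \<le> c))"
    by (simp add: trials_def sum_distrib_right)
  \<comment> \<open>Pointwise, \<open>x * of_bool (x \<le> c)\<close> is at most
    \<open>min c x\<close>.\<close>
  also have "\<dots> \<le> sales A c p"
    unfolding sales_def using assms(1)
    by (intro integral_mono integrable_bernoullis) auto
  finally show ?thesis .
qed

lemma expectation_trials:
  assumes "finite A" "\<And>t. t \<in> A \<Longrightarrow> p t \<in> {0..1}"
  shows "measure_pmf.expectation (bernoullis A p) (\<lambda>B. real (trials A B)) = (\<Sum>t\<in>A. p t)"
proof -
  have split: "real (trials A B) = (\<Sum>t\<in>A. of_bool (B t))" for B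
    unfolding trials_def of_nat_sum of_nat_of_bool ..
  have "measure_pmf.expectation (bernoullis A p) (\<lambda>B. of_bool (B t)) = p t" if "t \<in> A" for t
    using assms that by (subst expectation_bernoullis_split[of A t]) auto
  then show ?thesis
    unfolding split using assms(1)
    by (subst Bochner_Integration.integral_sum) (simp_all add: integrable_bernoullis)
qed

text \<open>For demands \<open>x\<close> under \<open>p\<close> and \<open>y\<close> under
  \<open>q\<close>, \<open>min c y \<le> min c x + y * of_bool (x < c)\<close>: either
  \<open>x\<close> already exhausts the stock, or \<open>y\<close> itself is the bound. With
  \<open>x\<close> and \<open>y\<close> independent, the expectation of the last product
  factors.\<close>

lemma sales_le_add_stock_prob:
  assumes "finite A"
    and p: "\<And>t. t \<in> A \<Longrightarrow> p t \<in> {0..1}" and q: "\<And>t. t \<in> A \<Longrightarrow> q t \<in> {0..1}"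
  shows "sales A c q \<le> sales A c p + (\<Sum>t\<in>A. q t * stock_prob A c p t)"
proof -
  let ?E = "measure_pmf.expectation (bernoullis A p)"
  define \<pi> :: real where "\<pi> = ?E (\<lambda>B. of_bool (trials A B < c))"
  \<comment> \<open>Ignoring the demand of period \<open>t\<close> can only leave more stock, so
    both conditional probabilities given \<open>B t\<close> are at most
    \<open>stock_prob A c p t\<close>.\<close>
  have stock: "\<pi> \<le> stock_prob A c p t" if "t \<in> A" for t
  proof -
    have "\<pi> \<le> p t * stock_prob A c p t + (1 - p t) * stock_prob A c p t"
      unfolding \<pi>_def stock_prob_def using that p[OF that] assms(1)
      by (subst expectation_bernoullis_split[of A t])
         (auto intro!: add_mono mult_left_mono integral_mono integrable_bernoullis)
    then show ?thesis by (simp add: algebra_simps)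
  qed
  have "sales A c q \<le> sales A c p + (\<Sum>t\<in>A. q t) * \<pi>"
  proof -
    \<comment> \<open>Averaging over \<open>y\<close> first, with \<open>x\<close> fixed, and over
      \<open>x\<close> afterwards replaces a product measure.\<close>
    have bound: "sales A c q \<le> real (min c x) + (\<Sum>t\<in>A. q t) * of_bool (x < c)" for x
    proof -
      have "sales A c q \<le> measure_pmf.expectation (bernoullis A q)
          (\<lambda>B. real (min c x) + real (trials A B) * of_bool (x < c))"
        unfolding sales_def using assms(1)
        by (intro integral_mono integrable_bernoullis) auto
      also have "\<dots> = real (min c x) + (\<Sum>t\<in>A. q t) * of_bool (x < c)"
        using assms(1) by (simp add: integrable_bernoullis expectation_trials[OF assms(1) q])
      finally show ?thesis .
    qed
    have "sales A c q = ?E (\<lambda>B. sales A c q)" by simp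
    also have "\<dots> \<le> ?E (\<lambda>B. real (min c (trials A B)) + (\<Sum>t\<in>A. q t) * of_bool (trials A B < c))"
      using assms(1) bound by (intro integral_mono integrable_bernoullis) auto
    also have "\<dots> = sales A c p + (\<Sum>t\<in>A. q t) * \<pi>"
      using assms(1) by (simp add: integrable_bernoullis sales_def \<pi>_def)
    finally show ?thesis .
  qed
  also have "\<dots> \<le> sales A c p + (\<Sum>t\<in>A. q t * stock_prob A c p t)"
    using stock q by (auto simp: sum_distrib_right intro!: sum_mono mult_left_mono)
  finally show ?thesis .
qed

section \<open>Effect of replacing one assortment on demand and revenue\<close>

lemma finite_index_sets [simp]:
  "finite (products M)" "finite (types M)" "finite (periods M)"
  by (simp_all add: products_def types_def periods_def)

lemma expected_revenue_sales:
  "expected_revenue M \<mu> = (\<Sum>i\<in>products M. unit_revenue M i *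
     sales (periods M) (inventory M i) (demand_prob M \<mu> i))"
  by (simp add: expected_revenue_def demands_def sales_def trials_def)

lemma sum_pmf_return:
  assumes "S \<in> A" "finite A"
  shows "(\<Sum>S'\<in>A. pmf (return_pmf S) S' * f S') = f S"
  using assms by (simp add: indicator_def of_bool_def if_distrib[of "\<lambda>x. x * _"] cong: if_cong)

lemma demand_prob_return:
  assumes "\<And>j. j \<in> types M \<Longrightarrow> \<mu> j t = return_pmf (S j)" "\<And>j. j \<in> types M \<Longrightarrow> S j \<subseteq> products M"
  shows "demand_prob M \<mu> i t = (\<Sum>j\<in>types M. arrival_prob M j t * choice_prob M i j (S j))"
  unfolding demand_prob_def using assms by (intro sum.cong refl) (simp add: sum_pmf_return del: pmf_return)

lemma demand_prob_modify_other:
  "s \<noteq> t \<Longrightarrow> demand_prob M (modify j t \<mu> S) i s = demand_prob M \<mu> i s"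
  by (auto simp: demand_prob_def modify_def intro!: sum.cong)

lemma demand_prob_modify_same:
  assumes "j \<in> types M" "\<mu> j t = return_pmf R" "R \<subseteq> products M" "S \<subseteq> products M"
  shows "demand_prob M (modify j t \<mu> S) i t =
    demand_prob M \<mu> i t + arrival_prob M j t * (choice_prob M i j S - choice_prob M i j R)"
proof -
  let ?f = "\<lambda>\<kappa> k. arrival_prob M k t * (\<Sum>A\<in>Pow (products M). pmf (\<kappa> k t) A * choice_prob M i k A)"
  have "(\<Sum>k\<in>types M - {j}. ?f (modify j t \<mu> S) k) = (\<Sum>k\<in>types M - {j}. ?f \<mu> k)"
    by (intro sum.cong) (auto simp: modify_def)
  moreover have "?f (modify j t \<mu> S) j = arrival_prob M j t * choice_prob M i j S"
    using assms by (simp add: modify_def sum_pmf_return del: pmf_return)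
  moreover have "?f \<mu> j = arrival_prob M j t * choice_prob M i j R"
    using assms by (simp add: sum_pmf_return del: pmf_return)
  moreover have "demand_prob M \<kappa> i t = ?f \<kappa> j + (\<Sum>k\<in>types M - {j}. ?f \<kappa> k)" for \<kappa>
    unfolding demand_prob_def using assms(1) by (intro sum.remove) simp_all
  ultimately show ?thesis
    by (simp only: right_diff_distrib)
qed

lemma sampling_policy_modify:
  assumes "sampling_policy M \<mu>" "S \<subseteq> products M"
  shows "sampling_policy M (modify j t \<mu> S)"
  using assms by (auto simp: sampling_policy_def modify_def)

text \<open>Only the demand of period \<open>t\<close> changes, so \<open>sales_change\<close> gives
  an exact formula for each product. Its slopes belong to \<open>\<mu>\<close> alone, so the effects
  of different single replacements can be added up.\<close>

lemma expected_revenue_modify: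
  assumes "valid_model M" "sampling_policy M \<mu>" "j \<in> types M" "t \<in> periods M"
    and "\<mu> j t = return_pmf R" "R \<subseteq> products M" "S \<subseteq> products M"
  shows "expected_revenue M (modify j t \<mu> S) = expected_revenue M \<mu> +
    (\<Sum>i\<in>products M. unit_revenue M i * (arrival_prob M j t *
       (choice_prob M i j S - choice_prob M i j R) *
       stock_prob (periods M) (inventory M i) (demand_prob M \<mu> i) t))"
proof -
  have "sales (periods M) (inventory M i) (demand_prob M (modify j t \<mu> S) i) =
      sales (periods M) (inventory M i) (demand_prob M \<mu> i) + arrival_prob M j t *
       (choice_prob M i j S - choice_prob M i j R) *
       stock_prob (periods M) (inventory M i) (demand_prob M \<mu> i) t"
    if "i \<in> products M" for i
  proof -
    have "demand_prob M \<mu> i t \<in> {0..1}" "demand_prob M (modify j t \<mu> S) i t \<in> {0..1}"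
      using assms(1,2,4) that sampling_policy_modify[OF assms(2,7), of j t]
      by (simp_all add: demand_prob_bounds)
    then show ?thesis
      using assms by (subst sales_change[of _ t "demand_prob M \<mu> i"])
        (simp_all add: demand_prob_modify_other demand_prob_modify_same)
  qed
  then show ?thesis
    by (simp add: expected_revenue_sales distrib_left sum.distrib)
qed

lemma deterministic_policyE:
  assumes "deterministic_policy M \<mu>"
  obtains S where "\<And>j t. j \<in> types M \<Longrightarrow> t \<in> periods M \<Longrightarrow> \<mu> j t = return_pmf (S j t)"
    "\<And>j t. j \<in> types M \<Longrightarrow> t \<in> periods M \<Longrightarrow> S j t \<subseteq> products M"
proof -
  obtain S where S: "\<And>j t. j \<in> types M \<Longrightarrow> t \<in> periods M \<Longrightarrow> \<mu> j t = return_pmf (S j t)"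
    using assms unfolding deterministic_policy_def by metis
  moreover have "S j t \<subseteq> products M" if "j \<in> types M" "t \<in> periods M" for j t
    using assms S[OF that] that unfolding deterministic_policy_def sampling_policy_def by fastforce
  ultimately show ?thesis by (rule that)
qed

section \<open>Comparison of a locally optimal policy with any deterministic policy\<close>

lemma locally_optimal_revenue_bound:
  assumes "valid_model M" "deterministic_policy M \<mu>" "deterministic_policy M \<nu>"
    and "locally_optimal M \<mu> \<delta>"
  shows "expected_revenue M \<nu> \<le>
    2 * expected_revenue M \<mu> + \<delta> * (real (num_types M) * real (num_periods M))"
proof -
  obtain R where R: "\<And>j t. j \<in> types M \<Longrightarrow> t \<in> periods M \<Longrightarrow> \<mu> j t = return_pmf (R j t)"
      "\<And>j t. j \<in> types M \<Longrightarrow> t \<in> periods M \<Longrightarrow> R j t \<subseteq> products M"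
    using assms(2) by (rule deterministic_policyE) blast
  obtain S where S: "\<And>j t. j \<in> types M \<Longrightarrow> t \<in> periods M \<Longrightarrow> \<nu> j t = return_pmf (S j t)"
      "\<And>j t. j \<in> types M \<Longrightarrow> t \<in> periods M \<Longrightarrow> S j t \<subseteq> products M"
    using assms(3) by (rule deterministic_policyE) blast
  have sampling: "sampling_policy M \<mu>" "sampling_policy M \<nu>"
    using assms(2,3) by (auto simp: deterministic_policy_def)
  define p where "p = demand_prob M \<mu>"
  define q where "q = demand_prob M \<nu>"
  define F where "F i = sales (periods M) (inventory M i)" for i
  define D where "D i t = stock_prob (periods M) (inventory M i) (p i) t" for i t
  have p: "p i t \<in> {0..1}" and q: "q i t \<in> {0..1}" if "i \<in> products M" "t \<in> periods M" for i t
    using that assms(1) sampling by (auto simp: p_def q_def demand_prob_bounds)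
  have r: "unit_revenue M i \<ge> 0" if "i \<in> products M" for i
    using assms(1) that by (simp add: valid_model_def)

  \<comment> \<open>Demand is additive over types, so passing from \<open>\<mu>\<close> to
    \<open>\<nu>\<close> splits into one replacement for each type and period.\<close>
  have diff: "q i t - p i t = (\<Sum>j\<in>types M. arrival_prob M j t *
      (choice_prob M i j (S j t) - choice_prob M i j (R j t)))" if "t \<in> periods M" for i t
    using that R S by (simp add: p_def q_def demand_prob_return[of M _ t "\<lambda>j. R j t"]
        demand_prob_return[of M _ t "\<lambda>j. S j t"] sum_subtractf right_diff_distrib)

  have "(\<Sum>i\<in>products M. unit_revenue M i * (\<Sum>t\<in>periods M. (q i t - p i t) * D i t)) =
      (\<Sum>i\<in>products M. \<Sum>t\<in>periods M. \<Sum>j\<in>types M. unit_revenue M i * (arrival_prob M j t *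
        (choice_prob M i j (S j t) - choice_prob M i j (R j t)) * D i t))"
    by (simp add: diff sum_distrib_left sum_distrib_right)
  also have "\<dots> = (\<Sum>t\<in>periods M. \<Sum>i\<in>products M. \<Sum>j\<in>types M. unit_revenue M i *
      (arrival_prob M j t * (choice_prob M i j (S j t) - choice_prob M i j (R j t)) * D i t))"
    by (rule sum.swap)
  also have "\<dots> = (\<Sum>t\<in>periods M. \<Sum>j\<in>types M. \<Sum>i\<in>products M. unit_revenue M i *
      (arrival_prob M j t * (choice_prob M i j (S j t) - choice_prob M i j (R j t)) * D i t))"
    by (intro sum.cong refl sum.swap)
  \<comment> \<open>For fixed \<open>t\<close> and \<open>j\<close>, the sum over products is the
    revenue change when \<open>S j t\<close> alone is put into \<open>\<mu>\<close>, which local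
    optimality bounds by \<open>\<delta>\<close>.\<close>
  also have "\<dots> = (\<Sum>t\<in>periods M. \<Sum>j\<in>types M.
      expected_revenue M (modify j t \<mu> (S j t)) - expected_revenue M \<mu>)"
    using R S assms(1) sampling
    by (intro sum.cong refl) (simp add: expected_revenue_modify D_def p_def)
  also have "\<dots> \<le> (\<Sum>t\<in>periods M. \<Sum>j\<in>types M. \<delta>)"
    using assms(4) S(2) by (intro sum_mono) (auto simp: locally_optimal_def diff_le_eq add.commute)
  also have "\<dots> = \<delta> * (real (num_types M) * real (num_periods M))"
    by (simp add: periods_def types_def)
  finally have local: "(\<Sum>i\<in>products M. unit_revenue M i * (\<Sum>t\<in>periods M. (q i t - p i t) * D i t))
      \<le> \<delta> * (real (num_types M) * real (num_periods M))" .

  \<comment> \<open>Writing \<open>q\<close> as \<open>(q - p) + p\<close> in the sum of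
    \<open>q i t * D i t\<close> leaves the sum of \<open>p i t * D i t\<close>, at most
    \<open>F i (p i)\<close>; this second copy of the sales is the source of the factor 2.\<close>
  have "F i (q i) \<le> 2 * F i (p i) + (\<Sum>t\<in>periods M. (q i t - p i t) * D i t)"
    if "i \<in> products M" for i
    using sales_le_add_stock_prob[of "periods M" "p i" "q i" "inventory M i"]
      sum_prob_weighted_stock_prob_le_sales[of "periods M" "p i" "inventory M i"] p[OF that] q[OF that]
    by (simp add: F_def D_def left_diff_distrib sum_subtractf)
  then have "(\<Sum>i\<in>products M. unit_revenue M i * F i (q i)) \<le> (\<Sum>i\<in>products M.
      unit_revenue M i * (2 * F i (p i) + (\<Sum>t\<in>periods M. (q i t - p i t) * D i t)))"
    using r by (intro sum_mono mult_left_mono)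
  also have "\<dots> = 2 * (\<Sum>i\<in>products M. unit_revenue M i * F i (p i)) +
      (\<Sum>i\<in>products M. unit_revenue M i * (\<Sum>t\<in>periods M. (q i t - p i t) * D i t))"
    unfolding distrib_left sum.distrib by (simp add: sum_distrib_left mult.left_commute)
  finally show ?thesis
    using local by (simp add: expected_revenue_sales F_def p_def q_def)
qed

theorem theorem4p1:
  fixes M :: assortment_model and \<mu> :: policy
  assumes "valid_model M"
    and "deterministic_policy M \<mu>"
  shows "(\<forall>\<delta>\<ge>0. locally_optimal M \<mu> \<delta> \<longrightarrow>
            expected_revenue M \<mu> \<ge>
              1/2 * opt_det M - \<delta> * (real (num_types M) * real (num_periods M) / 2)) \<and>
         (locally_optimal M \<mu> 0 \<longrightarrow> expected_revenue M \<mu> \<ge> 1/2 * opt_det M)"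
proof -
  obtain \<nu> where \<nu>: "deterministic_policy M \<nu>" "opt_det M = expected_revenue M \<nu>"
    using Max_in[OF finite_deterministic_revenues deterministic_revenues_nonempty]
    unfolding opt_det_def by blast
  have "expected_revenue M \<mu> \<ge>
      1/2 * opt_det M - \<delta> * (real (num_types M) * real (num_periods M) / 2)"
    if "locally_optimal M \<mu> \<delta>" for \<delta>
    using locally_optimal_revenue_bound[OF assms \<nu>(1) that] \<nu>(2) by simp
  from this this[of 0] show ?thesis by simp
qed

end
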